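(* If a normalized transition measure $P$ satisfies the condition $$C:=\sup_q\Big[\sum_{k=1}^n\ln\big(\sup_x\|\nu_{x,t_{k-1},t_k}\|\big)\Big]<\infty,$$ where the outer supremum is over all $q=(t_0,t_1,\dots,t_n)$ with pairwise distinct points $t_0,\dots,t_n\in T$ and $n\in\mathbf N$, then the Markov quasimeasure $\tilde\mu_{x_0}$ is bounded.
   Context: $\mathbf K$ is a local field; $T=B(\mathbf K,t_0,r)$ is a ball in $\mathbf K$ of radius $r>0$ containing $t_0$; $X_t=X$ for all $t\in T$, where $X$ is a locally $\mathbf K$-convex space, and $\mathsf U_t$ is a $\sigma$-algebra of subsets of $X_t$. $(\tilde X_T,\tilde{\mathsf U})=\prod_{t\in T}(X_t,\mathsf U_t)$, where $\tilde{\mathsf U}$ is generated by the cylinder sets. A function $P(t_1,x_1,t_2,A)\in\mathbf C$, $t_1\ne t_2\in T$, $x_1\in X_{t_1}$, $A\in\mathsf U_{t_2}$, is a transition measure if: (i) $\nu_{x_1,t_1,t_2}(A):=P(t_1,x_1,t_2,A)$ is a $\sigma$-additive measure on $(X_{t_2},\mathsf U_{t_2})$; (ii) $x_1\mapsto P(t_1,x_1,t_2,A)$ is $\mathsf U_{t_1}$-measurable; (iii) $P(t_1,x_1,t_2,A)=\int_{X_s}P(t_1,x_1,s,dy)P(s,y,t_2,A)$ for each $t_1\ne t_2\in T$ (and intermediate $s\in T$). It is normalized if (iv) $P(t_1,x_1,t_2,X_{t_2})=1$ for all $t_1\ne t_2$. For a complex measure $\nu=\nu_1-\nu_2+i\nu_3-i\nu_4$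 with $\nu_j$ nonnegative (Jordan decompositions of the real and imaginary parts), $\|\nu\|:=\sum_{j=1}^4\nu_j(X)$. Markov quasimeasure: fix $x_0\in X_{t_0}$. For $q=(t_0,t_1,\dots,t_{n+1})$ with pairwise distinct points of $T$, $s=q\setminus\{t_0\}$, $X^s=\prod_{t\in s}X_t$, $\mathsf U^s=\prod_{t\in s}\mathsf U_t$, put $\mu^q_{x_0}(E)=\int_E\prod_{k=1}^{n+1}P(t_{k-1},x_{k-1},t_k,dx_k)$ for $E\in\mathsf U^s$. These measures form a consistent family and induce the quasimeasure $\tilde\mu_{x_0}$ on cylinder sets of $\tilde X_T$ by $\tilde\mu_{x_0}(\pi_q^{-1}(E))=\mu^q_{x_0}(E)$, $\pi_q:\tilde X_T\to X^s$ the natural projection. "Bounded" means $\sup|\tilde\mu_{x_0}(A)|<\infty$ over all cylinder sets $A=\pi_q^{-1}(E)$, i.e. $\sup_{q,E}|\mu^q_{x_0}(E)|<\infty$. *)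

theory Defs
  imports "HOL-Analysis.Analysis"
begin

subsection \<open>Local fields and locally convex spaces over them\<close>

definition av_dist :: "('k::field \<Rightarrow> real) \<Rightarrow> 'k \<Rightarrow> 'k \<Rightarrow> real" where
  "av_dist av x y = av (x - y)"

text \<open>A local field is a field with a nontrivial non-Archimedean absolute value whose topology
  is locally compact.\<close>

locale local_field =
  fixes av :: "'k::field \<Rightarrow> real"
  assumes av_nonneg: "0 \<le> av x"
    and av_eq_0_iff: "av x = 0 \<longleftrightarrow> x = 0"
    and av_mult: "av (x * y) = av x * av y"
    and av_ultrametric: "av (x + y) \<le> max (av x) (av y)"
    and av_nontrivial: "\<exists>x. x \<noteq> 0 \<and> av x \<noteq> 1"
    and av_locally_compact: "locally_compact_space (Metric_space.mtopology UNIV (av_dist av))"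
begin

lemma av_1: "av 1 = 1"
  using av_mult[of 1 1] av_eq_0_iff[of 1] by simp

lemma av_uminus: "av (- x) = av x"
proof -
  have "av (- 1) * av (- 1) = 1"
    using av_mult[of "- 1" "- 1"] av_1 by simp
  hence "(av (- 1))\<^sup>2 = 1"
    by (simp add: power2_eq_square)
  hence "av (- 1) = 1"
    using av_nonneg[of "- 1"] by (auto simp: power2_eq_1_iff)
  thus ?thesis
    using av_mult[of "- 1" x] by simp
qed

lemma Metric_space_av_dist: "Metric_space UNIV (av_dist av)"
proof
  fix x y z
  show "0 \<le> av_dist av x y"
    by (simp add: av_dist_def av_nonneg)
  show "av_dist av x y = av_dist av y x"
    using av_uminus[of "x - y"] by (simp add: av_dist_def)
  show "av_dist av x y = 0 \<longleftrightarrow> x = y"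
    by (simp add: av_dist_def av_eq_0_iff)
  show "av_dist av x z \<le> av_dist av x y + av_dist av y z"
    using av_ultrametric[of "x - y" "y - z"] av_nonneg[of "x - y"] av_nonneg[of "y - z"]
    by (simp add: av_dist_def)
qed

end

definition absolutely_convex ::
    "('k::field \<Rightarrow> real) \<Rightarrow> ('k \<Rightarrow> 'x::ab_group_add \<Rightarrow> 'x) \<Rightarrow> 'x set \<Rightarrow> bool" where
  "absolutely_convex av smul W \<longleftrightarrow>
     (\<forall>a b. \<forall>x\<in>W. \<forall>y\<in>W. av a \<le> 1 \<longrightarrow> av b \<le> 1 \<longrightarrow> smul a x + smul b y \<in> W)"

locale locally_convex_space = local_field av + vector_space smul
  for av :: "'k::field \<Rightarrow> real"
    and smul :: "'k \<Rightarrow> 'x::topological_ab_group_add \<Rightarrow> 'x" +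
  assumes continuous_smul:
      "continuous_map (prod_topology (Metric_space.mtopology UNIV (av_dist av)) euclidean)
         euclidean (\<lambda>(a, x). smul a x)"
    and convex_nhds_0_base:
      "open V \<Longrightarrow> 0 \<in> V \<Longrightarrow> \<exists>W\<subseteq>V. absolutely_convex av smul W \<and> 0 \<in> interior W"

subsection \<open>Complex measures\<close>

text \<open>Of the \<open>'a measure\<close> argument \<open>M\<close> below, only the underlying measurable space is used.\<close>

definition complex_measure :: "'a measure \<Rightarrow> ('a set \<Rightarrow> complex) \<Rightarrow> bool" where
  "complex_measure M \<nu> \<longleftrightarrow> \<nu> {} = 0 \<and>
     (\<forall>A. range A \<subseteq> sets M \<longrightarrow> disjoint_family A \<longrightarrow>
        (\<lambda>n::nat. \<nu> (A n)) sums \<nu> (\<Union>n. A n))"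

definition jordan_decomposition ::
    "'a measure \<Rightarrow> ('a set \<Rightarrow> real) \<Rightarrow> 'a measure \<Rightarrow> 'a measure \<Rightarrow> bool" where
  "jordan_decomposition M \<rho> N\<^sub>1 N\<^sub>2 \<longleftrightarrow>
     finite_measure N\<^sub>1 \<and> finite_measure N\<^sub>2 \<and> sets N\<^sub>1 = sets M \<and> sets N\<^sub>2 = sets M \<and>
     (\<exists>S\<in>sets M. emeasure N\<^sub>1 (space M - S) = 0 \<and> emeasure N\<^sub>2 S = 0) \<and>
     (\<forall>A\<in>sets M. \<rho> A = measure N\<^sub>1 A - measure N\<^sub>2 A)"

text \<open>By the Jordan decomposition theorem, for a \<open>\<sigma>\<close>-additive \<open>\<rho>\<close> the pair chosen here exists
  and is unique.\<close>

definition jordan_parts :: "'a measure \<Rightarrow> ('a set \<Rightarrow> real) \<Rightarrow> 'a measure \<times> 'a measure" where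
  "jordan_parts M \<rho> = (SOME (N\<^sub>1, N\<^sub>2). jordan_decomposition M \<rho> N\<^sub>1 N\<^sub>2)"

definition re_pos :: "'a measure \<Rightarrow> ('a set \<Rightarrow> complex) \<Rightarrow> 'a measure" where
  "re_pos M \<nu> = fst (jordan_parts M (\<lambda>A. Re (\<nu> A)))"

definition re_neg :: "'a measure \<Rightarrow> ('a set \<Rightarrow> complex) \<Rightarrow> 'a measure" where
  "re_neg M \<nu> = snd (jordan_parts M (\<lambda>A. Re (\<nu> A)))"

definition im_pos :: "'a measure \<Rightarrow> ('a set \<Rightarrow> complex) \<Rightarrow> 'a measure" where
  "im_pos M \<nu> = fst (jordan_parts M (\<lambda>A. Im (\<nu> A)))"

definition im_neg :: "'a measure \<Rightarrow> ('a set \<Rightarrow> complex) \<Rightarrow> 'a measure" where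
  "im_neg M \<nu> = snd (jordan_parts M (\<lambda>A. Im (\<nu> A)))"

definition cm_norm :: "'a measure \<Rightarrow> ('a set \<Rightarrow> complex) \<Rightarrow> real" where
  "cm_norm M \<nu> =
     measure (re_pos M \<nu>) (space M) + measure (re_neg M \<nu>) (space M) +
     measure (im_pos M \<nu>) (space M) + measure (im_neg M \<nu>) (space M)"

definition cm_integrable ::
    "'a measure \<Rightarrow> ('a set \<Rightarrow> complex) \<Rightarrow> ('a \<Rightarrow> complex) \<Rightarrow> bool" where
  "cm_integrable M \<nu> f \<longleftrightarrow>
     integrable (re_pos M \<nu>) f \<and> integrable (re_neg M \<nu>) f \<and>
     integrable (im_pos M \<nu>) f \<and> integrable (im_neg M \<nu>) f"

definition cm_integral ::
    "'a measure \<Rightarrow> ('a set \<Rightarrow> complex) \<Rightarrow> ('a \<Rightarrow> complex) \<Rightarrow> complex" where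
  "cm_integral M \<nu> f =
     (integral\<^sup>L (re_pos M \<nu>) f - integral\<^sup>L (re_neg M \<nu>) f) +
     \<i> * (integral\<^sup>L (im_pos M \<nu>) f - integral\<^sup>L (im_neg M \<nu>) f)"

subsection \<open>Transition measures\<close>

text \<open>\<open>U t\<close> carries the \<open>\<sigma>\<close>-algebra at time \<open>t\<close>, and \<open>P t\<^sub>1 x\<^sub>1 t\<^sub>2\<close> is the set function
  \<open>\<nu>\<close> with indices \<open>x\<^sub>1, t\<^sub>1, t\<^sub>2\<close>. The values of \<open>P\<close> at \<open>t\<^sub>1 = t\<^sub>2\<close> or outside \<open>T\<close> are irrelevant;
  hence the intermediate time \<open>s\<close> differs from \<open>t\<^sub>1\<close> and \<open>t\<^sub>2\<close>.\<close>

locale transition_measure =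
  fixes T :: "'k set"
    and U :: "'k \<Rightarrow> 'x measure"
    and P :: "'k \<Rightarrow> 'x \<Rightarrow> 'k \<Rightarrow> 'x set \<Rightarrow> complex"
  assumes sigma_additive:
      "\<lbrakk>t\<^sub>1 \<in> T; t\<^sub>2 \<in> T; t\<^sub>1 \<noteq> t\<^sub>2; x \<in> space (U t\<^sub>1)\<rbrakk> \<Longrightarrow> complex_measure (U t\<^sub>2) (P t\<^sub>1 x t\<^sub>2)"
    and measurable:
      "\<lbrakk>t\<^sub>1 \<in> T; t\<^sub>2 \<in> T; t\<^sub>1 \<noteq> t\<^sub>2; A \<in> sets (U t\<^sub>2)\<rbrakk> \<Longrightarrow>
         (\<lambda>x. P t\<^sub>1 x t\<^sub>2 A) \<in> borel_measurable (U t\<^sub>1)"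
    and chapman_kolmogorov_integrable:
      "\<lbrakk>t\<^sub>1 \<in> T; t\<^sub>2 \<in> T; t\<^sub>1 \<noteq> t\<^sub>2; s \<in> T; s \<noteq> t\<^sub>1; s \<noteq> t\<^sub>2; x \<in> space (U t\<^sub>1); A \<in> sets (U t\<^sub>2)\<rbrakk> \<Longrightarrow>
         cm_integrable (U s) (P t\<^sub>1 x s) (\<lambda>y. P s y t\<^sub>2 A)"
    and chapman_kolmogorov:
      "\<lbrakk>t\<^sub>1 \<in> T; t\<^sub>2 \<in> T; t\<^sub>1 \<noteq> t\<^sub>2; s \<in> T; s \<noteq> t\<^sub>1; s \<noteq> t\<^sub>2; x \<in> space (U t\<^sub>1); A \<in> sets (U t\<^sub>2)\<rbrakk> \<Longrightarrow>
         P t\<^sub>1 x t\<^sub>2 A = cm_integral (U s) (P t\<^sub>1 x s) (\<lambda>y. P s y t\<^sub>2 A)"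

locale normalized_transition_measure = transition_measure +
  assumes normalized:
      "\<lbrakk>t\<^sub>1 \<in> T; t\<^sub>2 \<in> T; t\<^sub>1 \<noteq> t\<^sub>2; x \<in> space (U t\<^sub>1)\<rbrakk> \<Longrightarrow> P t\<^sub>1 x t\<^sub>2 (space (U t\<^sub>2)) = 1"

text \<open>The tuples \<open>q = (t\<^sub>0, t\<^sub>1, \<dots>, t\<^sub>n)\<close>, \<open>n \<ge> 1\<close>, of pairwise distinct points of \<open>T\<close>, as lists.\<close>

definition time_tuples :: "'k set \<Rightarrow> 'k \<Rightarrow> 'k list set" where
  "time_tuples T t\<^sub>0 = {q. length q \<ge> 2 \<and> hd q = t\<^sub>0 \<and> distinct q \<and> set q \<subseteq> T}"

definition ereal_ln :: "ereal \<Rightarrow> ereal" where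
  "ereal_ln x = (if x \<le> 0 then -\<infinity> else if x = \<infinity> then \<infinity> else ereal (ln (real_of_ereal x)))"

definition transition_sup ::
    "('k \<Rightarrow> 'x measure) \<Rightarrow> ('k \<Rightarrow> 'x \<Rightarrow> 'k \<Rightarrow> 'x set \<Rightarrow> complex) \<Rightarrow> 'k \<Rightarrow> 'k \<Rightarrow> ereal" where
  "transition_sup U P s t = (SUP x\<in>space (U s). ereal (cm_norm (U t) (P s x t)))"

definition transition_bound ::
    "'k set \<Rightarrow> 'k \<Rightarrow> ('k \<Rightarrow> 'x measure) \<Rightarrow> ('k \<Rightarrow> 'x \<Rightarrow> 'k \<Rightarrow> 'x set \<Rightarrow> complex) \<Rightarrow> ereal" where
  "transition_bound T t\<^sub>0 U P =
     (SUP q\<in>time_tuples T t\<^sub>0. \<Sum>k=1..<length q. ereal_ln (transition_sup U P (q ! (k - 1)) (q ! k)))"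

subsection \<open>Markov quasimeasures\<close>

text \<open>The integral of \<open>F\<close> over the coordinates listed in \<open>ts\<close>, iterated along the path that
  starts from \<open>x\<close> at time \<open>t\<close>; \<open>w\<close> collects the coordinates already chosen.\<close>

fun path_integral ::
    "('k \<Rightarrow> 'x measure) \<Rightarrow> ('k \<Rightarrow> 'x \<Rightarrow> 'k \<Rightarrow> 'x set \<Rightarrow> complex) \<Rightarrow> (('k \<Rightarrow> 'x) \<Rightarrow> complex) \<Rightarrow>
     'k \<Rightarrow> 'x \<Rightarrow> 'k list \<Rightarrow> ('k \<Rightarrow> 'x) \<Rightarrow> complex" where
  "path_integral U P F t x [] w = F w"
| "path_integral U P F t x (u # us) w =
     cm_integral (U u) (P t x u) (\<lambda>y. path_integral U P F u y us (w(u := y)))"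

text \<open>Starting from the everywhere undefined point makes all paths extensional, i.e. elements of
  the space of \<open>PiM (set (tl q)) U\<close>.\<close>

definition markov_measure ::
    "('k \<Rightarrow> 'x measure) \<Rightarrow> ('k \<Rightarrow> 'x \<Rightarrow> 'k \<Rightarrow> 'x set \<Rightarrow> complex) \<Rightarrow> 'x \<Rightarrow> 'k list \<Rightarrow>
     ('k \<Rightarrow> 'x) set \<Rightarrow> complex" where
  "markov_measure U P x\<^sub>0 q E = path_integral U P (indicator E) (hd q) x\<^sub>0 (tl q) (\<lambda>_. undefined)"

text \<open>The quasimeasure is represented by its graph, the set of all pairs of a cylinder set
  \<open>prod_emb T U (set (tl q)) E\<close> (the preimage of \<open>E\<close> in the product over \<open>T\<close>) and the value
  \<open>markov_measure U P x\<^sub>0 q E\<close> assigned to it. So nothing depends on a choice of a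
  representation of a cylinder set.\<close>

definition markov_quasimeasure ::
    "'k set \<Rightarrow> 'k \<Rightarrow> ('k \<Rightarrow> 'x measure) \<Rightarrow> ('k \<Rightarrow> 'x \<Rightarrow> 'k \<Rightarrow> 'x set \<Rightarrow> complex) \<Rightarrow> 'x \<Rightarrow>
     (('k \<Rightarrow> 'x) set \<times> complex) set" where
  "markov_quasimeasure T t\<^sub>0 U P x\<^sub>0 =
     {(prod_emb T U (set (tl q)) E, markov_measure U P x\<^sub>0 q E) | q E.
        q \<in> time_tuples T t\<^sub>0 \<and> E \<in> sets (PiM (set (tl q)) U)}"

definition bounded_quasimeasure :: "('a set \<times> complex) set \<Rightarrow> bool" where
  "bounded_quasimeasure Q \<longleftrightarrow> (SUP (A, c)\<in>Q. ereal (cmod c)) < \<infinity>"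

end

theory Submission
  imports Defs
begin

text \<open>
  The value \<open>\<mu>\<^sup>q(E)\<close> is an iterated integral of an indicator function along the path
  \<open>t\<^sub>0, t\<^sub>1, \<dots>, t\<^sub>n\<close>. Integrating a function bounded by \<open>B\<close> against a complex measure \<open>\<nu>\<close>
  gives at most \<open>B \<parallel>\<nu>\<parallel>\<close> in modulus (\<open>norm_cm_integral_le\<close>). So the step from one time to the next
  costs at most a factor \<open>c\<^sub>k\<close>, the supremum over the starting points \<open>x\<close> of the norms of the
  transition measures of this step, and \<open>\<bar>\<mu>\<^sup>q(E)\<bar> \<le> c\<^sub>1 \<cdots> c\<^sub>n\<close> (\<open>norm_path_integral_le\<close>). As
  \<open>ln c\<^sub>1 + \<cdots> + ln c\<^sub>n\<close> is one of the sums whose supremum is \<open>C\<close>, this product is at most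
  \<open>exp C\<close>, a bound independent of \<open>q\<close> and \<open>E\<close>. Normalization gives \<open>\<parallel>\<nu>\<parallel> \<ge> \<bar>\<nu>(X)\<bar> = 1\<close>. Hence no
  logarithm is negative, an infinite \<open>c\<^sub>k\<close> would make the sum infinite, and for finite \<open>c\<^sub>k\<close> the
  product is the exponential of the sum.

  The norm and the integral are both expressed by the Jordan parts of \<open>\<nu>\<close>. That these parts are
  finite measures with the right difference rests on the Hahn decomposition of a signed measure:
  each measurable set contains a positive set of at least the same measure
  (\<open>positive_subset\<close>), and a countable union of positive sets whose measures approach the supremum
  is positive and attains it, so that nothing outside of it can have positive measure.
\<close>

section \<open>The Hahn and Jordan decompositions of a signed measure\<close>

locale signed_measure =
  fixes M :: "'a measure" and \<rho> :: "'a set \<Rightarrow> real"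
  assumes empty: "\<rho> {} = 0"
    and sums_UN: "range A \<subseteq> sets M \<Longrightarrow> disjoint_family A \<Longrightarrow> (\<lambda>n::nat. \<rho> (A n)) sums \<rho> (\<Union>n. A n)"
begin

lemma Un:
  assumes "A \<in> sets M" "B \<in> sets M" "A \<inter> B = {}"
  shows "\<rho> (A \<union> B) = \<rho> A + \<rho> B"
proof -
  have "(\<lambda>n. \<rho> (binaryset A B n)) sums \<rho> (\<Union>n. binaryset A B n)"
    using assms by (intro sums_UN) (auto simp: range_binaryset_eq disjoint_family_on_def binaryset_def)
  moreover have "(\<lambda>n. \<rho> (binaryset A B n)) sums (\<rho> A + \<rho> B)"
    using binaryset_sums[of \<rho> A B] empty by simp
  ultimately show ?thesis
    by (simp add: UN_binaryset_eq sums_unique2)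
qed

lemma Diff:
  assumes "A \<in> sets M" "B \<in> sets M" "B \<subseteq> A"
  shows "\<rho> (A - B) = \<rho> A - \<rho> B"
proof -
  have "\<rho> ((A - B) \<union> B) = \<rho> (A - B) + \<rho> B"
    using assms by (intro Un) auto
  moreover have "(A - B) \<union> B = A"
    using assms by auto
  ultimately show ?thesis by simp
qed

lemma tendsto_INT:
  assumes E: "\<And>n. E n \<in> sets M" and dec: "\<And>n. E (Suc n) \<subseteq> E n"
  shows "(\<lambda>n. \<rho> (E n)) \<longlonglongrightarrow> \<rho> (\<Inter>n. E n)"
proof -
  have anti: "E n \<subseteq> E m" if "m \<le> n" for m n
    using that dec by (rule lift_Suc_antimono_le[rotated])
  define D where "D n = E n - E (Suc n)" for n
  have "disjoint_family D"
    unfolding disjoint_family_on_def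
  proof (intro ballI impI)
    fix m n :: nat
    assume "m \<noteq> n"
    then consider "Suc m \<le> n" | "Suc n \<le> m" by linarith
    then show "D m \<inter> D n = {}"
      using anti by cases (fastforce simp: D_def)+
  qed
  moreover have "range D \<subseteq> sets M"
    using E by (auto simp: D_def)
  ultimately have "(\<lambda>n. \<rho> (D n)) sums \<rho> (\<Union>n. D n)"
    by (intro sums_UN)
  moreover have "(\<Union>n. D n) = E 0 - (\<Inter>n. E n)"
  proof (intro equalityI subsetI)
    fix x assume "x \<in> (\<Union>n. D n)"
    then show "x \<in> E 0 - (\<Inter>n. E n)"
      using anti[of 0] by (auto simp: D_def)
  next
    fix x assume x: "x \<in> E 0 - (\<Inter>n. E n)"
    show "x \<in> (\<Union>n. D n)"
    proof (rule ccontr)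
      assume "x \<notin> (\<Union>n. D n)"
      then have "x \<in> E n" for n
        using x by (induction n) (auto simp: D_def)
      then show False using x by auto
    qed
  qed
  moreover have "\<rho> (E 0 - (\<Inter>n. E n)) = \<rho> (E 0) - \<rho> (\<Inter>n. E n)"
    using E by (intro Diff) auto
  moreover have "(\<Sum>k<n. \<rho> (D k)) = \<rho> (E 0) - \<rho> (E n)" for n
    using E dec sum_lessThan_telescope'[of "\<lambda>n. \<rho> (E n)" n] by (simp add: D_def Diff)
  ultimately have "(\<lambda>n. \<rho> (E 0) - \<rho> (E n)) \<longlonglongrightarrow> \<rho> (E 0) - \<rho> (\<Inter>n. E n)"
    by (simp add: sums_def)
  from tendsto_diff[OF tendsto_const[of "\<rho> (E 0)"] this] show ?thesis
    by simp
qed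

definition positive_set :: "'a set \<Rightarrow> bool" where
  "positive_set S \<longleftrightarrow> S \<in> sets M \<and> (\<forall>B\<in>sets M. B \<subseteq> S \<longrightarrow> 0 \<le> \<rho> B)"

text \<open>Removing a subset of measure at most \<open>-\<epsilon>\<close> increases the measure by at least \<open>\<epsilon>\<close>. If this
  could go on forever, the measures of the remaining sets would increase without bound, although
  they converge to the measure of the intersection.\<close>

lemma nearly_positive_subset:
  assumes E: "E \<in> sets M" and \<epsilon>: "0 < \<epsilon>"
  obtains F where "F \<in> sets M" "F \<subseteq> E" "\<rho> E \<le> \<rho> F"
    "\<And>B. B \<in> sets M \<Longrightarrow> B \<subseteq> F \<Longrightarrow> - \<epsilon> < \<rho> B"
proof (rule ccontr)
  note F_thesis = that
  assume "\<not> thesis"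
  have bad: "\<exists>B\<in>sets M. B \<subseteq> F \<and> \<rho> B \<le> - \<epsilon>"
    if "F \<in> sets M" "F \<subseteq> E" "\<rho> E \<le> \<rho> F" for F
  proof (rule ccontr)
    assume "\<not> ?thesis"
    then have "- \<epsilon> < \<rho> B" if "B \<in> sets M" "B \<subseteq> F" for B
      using that by force
    then show False
      using F_thesis[OF that] \<open>\<not> thesis\<close> by blast
  qed
  have "\<exists>F. \<forall>n. (F n \<in> sets M \<and> F n \<subseteq> E \<and> \<rho> E \<le> \<rho> (F n)) \<and>
      (F (Suc n) \<subseteq> F n \<and> \<rho> (F n) + \<epsilon> \<le> \<rho> (F (Suc n)))"
  proof (rule dependent_nat_choice)
    show "\<exists>F. F \<in> sets M \<and> F \<subseteq> E \<and> \<rho> E \<le> \<rho> F"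
      using E by auto
  next
    fix F and n :: nat
    assume F: "F \<in> sets M \<and> F \<subseteq> E \<and> \<rho> E \<le> \<rho> F"
    then obtain B where B: "B \<in> sets M" "B \<subseteq> F" "\<rho> B \<le> - \<epsilon>"
      using bad by blast
    then have "\<rho> (F - B) = \<rho> F - \<rho> B"
      using F by (intro Diff) auto
    then show "\<exists>G. (G \<in> sets M \<and> G \<subseteq> E \<and> \<rho> E \<le> \<rho> G) \<and> (G \<subseteq> F \<and> \<rho> F + \<epsilon> \<le> \<rho> G)"
      using F B \<epsilon> by (intro exI[of _ "F - B"]) auto
  qed
  then obtain F where F: "\<And>n. F n \<in> sets M" "\<And>n. F (Suc n) \<subseteq> F n"
    "\<And>n. \<rho> (F n) + \<epsilon> \<le> \<rho> (F (Suc n))"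
    by blast
  have lim: "(\<lambda>n. \<rho> (F n)) \<longlonglongrightarrow> \<rho> (\<Inter>n. F n)"
    using F by (intro tendsto_INT) auto
  have "(\<lambda>n. \<rho> (F (Suc n)) - \<rho> (F n)) \<longlonglongrightarrow> 0"
    using tendsto_diff[OF LIMSEQ_Suc[OF lim] lim] by simp
  then have "\<epsilon> \<le> 0"
    by (rule tendsto_lowerbound) (use F(3) in \<open>auto intro!: always_eventually simp: le_diff_eq add.commute\<close>)
  with \<epsilon> show False by simp
qed

text \<open>Every subset \<open>B\<close> of the intersection of a decreasing sequence of sets as above, with
  tolerances \<open>1/n\<close>, satisfies \<open>- 1/n < \<rho> B\<close> for all \<open>n\<close>.\<close>

lemma positive_subset:
  assumes E: "E \<in> sets M"
  obtains S where "positive_set S" "S \<subseteq> E" "\<rho> E \<le> \<rho> S"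
proof -
  have "\<exists>F. \<forall>n. (F n \<in> sets M \<and> F n \<subseteq> E \<and> \<rho> E \<le> \<rho> (F n)) \<and>
      (F (Suc n) \<subseteq> F n \<and> (\<forall>B\<in>sets M. B \<subseteq> F (Suc n) \<longrightarrow> - inverse (real (Suc n)) < \<rho> B))"
  proof (rule dependent_nat_choice)
    show "\<exists>F. F \<in> sets M \<and> F \<subseteq> E \<and> \<rho> E \<le> \<rho> F"
      using E by auto
  next
    fix F and n :: nat
    assume F: "F \<in> sets M \<and> F \<subseteq> E \<and> \<rho> E \<le> \<rho> F"
    obtain G where "G \<in> sets M" "G \<subseteq> F" "\<rho> F \<le> \<rho> G"
      "\<And>B. B \<in> sets M \<Longrightarrow> B \<subseteq> G \<Longrightarrow> - inverse (real (Suc n)) < \<rho> B"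
      by (rule nearly_positive_subset[of F "inverse (real (Suc n))"]) (use F in auto)
    then show "\<exists>G. (G \<in> sets M \<and> G \<subseteq> E \<and> \<rho> E \<le> \<rho> G) \<and>
        (G \<subseteq> F \<and> (\<forall>B\<in>sets M. B \<subseteq> G \<longrightarrow> - inverse (real (Suc n)) < \<rho> B))"
      using F by (intro exI[of _ G]) auto
  qed
  then obtain F where F: "\<And>n. F n \<in> sets M" "\<And>n. F n \<subseteq> E" "\<And>n. \<rho> E \<le> \<rho> (F n)"
    "\<And>n. F (Suc n) \<subseteq> F n"
    and small: "\<And>n B. B \<in> sets M \<Longrightarrow> B \<subseteq> F (Suc n) \<Longrightarrow> - inverse (real (Suc n)) < \<rho> B"
    by blast
  have "positive_set (\<Inter>n. F n)"
    unfolding positive_set_def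
  proof (intro conjI ballI impI)
    show "(\<Inter>n. F n) \<in> sets M"
      using F by auto
  next
    fix B assume B: "B \<in> sets M" "B \<subseteq> (\<Inter>n. F n)"
    have "- inverse (real (Suc n)) \<le> \<rho> B" for n
      using small[of B n] B by fastforce
    moreover have "(\<lambda>n. - inverse (real (Suc n))) \<longlonglongrightarrow> 0"
      using tendsto_minus[OF LIMSEQ_inverse_real_of_nat] by simp
    ultimately show "0 \<le> \<rho> B"
      by (intro LIMSEQ_le_const2) auto
  qed
  moreover have "\<rho> E \<le> \<rho> (\<Inter>n. F n)"
    using F by (intro LIMSEQ_le_const[OF tendsto_INT]) auto
  moreover have "(\<Inter>n. F n) \<subseteq> E"
    using F(2) by blast
  ultimately show thesis
    by (rule_tac that)
qed

lemma positive_set_UN: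
  fixes S :: "nat \<Rightarrow> 'a set"
  assumes S: "\<And>n. positive_set (S n)"
  shows "positive_set (\<Union>n. S n)"
  unfolding positive_set_def
proof (intro conjI ballI impI)
  show "(\<Union>n. S n) \<in> sets M"
    using S by (auto simp: positive_set_def)
next
  fix B assume B: "B \<in> sets M" "B \<subseteq> (\<Union>n. S n)"
  let ?D = "\<lambda>n. B \<inter> disjointed S n"
  have D: "?D n \<in> sets M" for n
    using S B sets.range_disjointed_sets[of S M] by (auto simp: positive_set_def)
  have "(\<lambda>n. \<rho> (?D n)) sums \<rho> (\<Union>n. ?D n)"
    using D disjoint_family_disjointed[of S] by (intro sums_UN) (auto simp: disjoint_family_on_def)
  moreover have "(\<Union>n. ?D n) = B"
    using B UN_disjointed_eq[of S] by auto
  moreover have "0 \<le> \<rho> (?D n)" for n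
    using S[of n] D[of n] disjointed_subset[of S n] by (auto simp: positive_set_def)
  ultimately show "0 \<le> \<rho> B"
    using sums_le[OF _ sums_zero, of "\<lambda>n. \<rho> (?D n)" "\<rho> B"] by simp
qed

lemma Hahn_decomposition:
  obtains S where "positive_set S" "\<And>B. B \<in> sets M \<Longrightarrow> B \<inter> S = {} \<Longrightarrow> \<rho> B \<le> 0"
proof -
  \<comment> \<open>The supremum is taken in the extended reals; that it is finite comes out at the end, because
    it is attained at \<open>H\<close>.\<close>
  have "\<exists>f. range f \<subseteq> (\<lambda>E. ereal (\<rho> E)) ` sets M \<and>
      (SUP E\<in>sets M. ereal (\<rho> E)) = (SUP n::nat. f n)"
    by (rule SUP_countable_SUP) auto
  then obtain f :: "nat \<Rightarrow> ereal" where f: "\<And>n. f n \<in> (\<lambda>E. ereal (\<rho> E)) ` sets M"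
    and Sup: "(SUP E\<in>sets M. ereal (\<rho> E)) = (SUP n. f n)"
    by blast
  have "\<exists>S. positive_set S \<and> f n \<le> ereal (\<rho> S)" for n
  proof -
    obtain E where "E \<in> sets M" "f n = ereal (\<rho> E)"
      using f[of n] by blast
    with positive_subset[of E] show ?thesis by (metis ereal_less_eq(3))
  qed
  then obtain S where S: "\<And>n. positive_set (S n)" and fS: "\<And>n. f n \<le> ereal (\<rho> (S n))"
    by metis
  define H where "H = (\<Union>n. S n)"
  have H: "positive_set H"
    unfolding H_def by (rule positive_set_UN) (rule S)
  have "\<rho> (S n) \<le> \<rho> H" for n
  proof -
    have "0 \<le> \<rho> (H - S n)" "\<rho> (H - S n) = \<rho> H - \<rho> (S n)"
      using H S[of n] by (auto simp: positive_set_def H_def intro!: Diff)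
    then show ?thesis by simp
  qed
  then have "(SUP n. f n) \<le> ereal (\<rho> H)"
    using fS by (intro SUP_least) (meson ereal_less_eq(3) order_trans)
  then have max: "\<rho> E \<le> \<rho> H" if "E \<in> sets M" for E
    using that Sup SUP_upper[of E "sets M" "\<lambda>E. ereal (\<rho> E)"]
    by (metis ereal_less_eq(3) order_trans)
  show thesis
  proof (rule that[OF H])
    fix B assume "B \<in> sets M" "B \<inter> H = {}"
    then show "\<rho> B \<le> 0"
      using max[of "H \<union> B"] Un[of H B] H by (auto simp: positive_set_def Int_commute)
  qed
qed

lemma finite_measure_of_nonneg:
  assumes nonneg: "\<And>A. A \<in> sets M \<Longrightarrow> 0 \<le> \<rho> A"
  obtains N where "finite_measure N" "sets N = sets M" "\<And>A. A \<in> sets M \<Longrightarrow> emeasure N A = ennreal (\<rho> A)"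
proof -
  define N where "N = measure_of (space M) (sets M) (\<lambda>A. ennreal (\<rho> A))"
  have sets: "sets N = sets M"
    by (simp add: N_def)
  have "countably_additive (sets M) (\<lambda>A. ennreal (\<rho> A))"
    unfolding countably_additive_def
  proof (intro allI impI)
    fix A :: "nat \<Rightarrow> 'a set"
    assume A: "range A \<subseteq> sets M" "disjoint_family A"
    from sums_UN[OF A] have "(\<lambda>n. ennreal (\<rho> (A n))) sums ennreal (\<rho> (\<Union>n. A n))"
      using A nonneg by (subst sums_ennreal) auto
    then show "(\<Sum>n. ennreal (\<rho> (A n))) = ennreal (\<rho> (\<Union>n. A n))"
      by (rule sums_unique[symmetric])
  qed
  then have em: "emeasure N A = ennreal (\<rho> A)" if "A \<in> sets M" for A
    using that empty unfolding N_def
    by (intro emeasure_measure_of_sigma sets.sigma_algebra_axioms) (auto simp: positive_def)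
  have "space N = space M"
    by (simp add: N_def)
  then have "finite_measure N"
    using em[of "space M"] by (intro finite_measureI) auto
  with sets em show thesis
    by (rule_tac that)
qed

end

text \<open>Restricting \<open>\<rho>\<close> to a Hahn set and to its complement gives two mutually singular set functions
  of constant sign.\<close>

lemma (in signed_measure) Jordan_decomposition:
  "\<exists>N\<^sub>1 N\<^sub>2. jordan_decomposition M \<rho> N\<^sub>1 N\<^sub>2"
proof -
  obtain S where S: "positive_set S" and neg: "\<And>B. B \<in> sets M \<Longrightarrow> B \<inter> S = {} \<Longrightarrow> \<rho> B \<le> 0"
    by (rule Hahn_decomposition) blast
  have [measurable]: "S \<in> sets M"
    using S by (simp add: positive_set_def)
  interpret pos: signed_measure M "\<lambda>A. \<rho> (A \<inter> S)"
  proof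
    fix A :: "nat \<Rightarrow> 'a set" assume "range A \<subseteq> sets M" "disjoint_family A"
    then have "(\<lambda>n. \<rho> (A n \<inter> S)) sums \<rho> (\<Union>n. A n \<inter> S)"
      by (intro sums_UN) (auto simp: disjoint_family_on_def)
    then show "(\<lambda>n. \<rho> (A n \<inter> S)) sums \<rho> ((\<Union>n. A n) \<inter> S)"
      by simp
  qed (simp add: empty)
  interpret neg: signed_measure M "\<lambda>A. - \<rho> (A - S)"
  proof
    fix A :: "nat \<Rightarrow> 'a set" assume "range A \<subseteq> sets M" "disjoint_family A"
    then have "(\<lambda>n. \<rho> (A n - S)) sums \<rho> (\<Union>n. A n - S)"
      by (intro sums_UN) (auto simp: disjoint_family_on_def)
    moreover have "(\<Union>n. A n - S) = (\<Union>n. A n) - S"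
      by auto
    ultimately show "(\<lambda>n. - \<rho> (A n - S)) sums - \<rho> ((\<Union>n. A n) - S)"
      by (metis sums_minus)
  qed (simp add: empty)
  obtain N\<^sub>1 where N\<^sub>1: "finite_measure N\<^sub>1" "sets N\<^sub>1 = sets M"
    "\<And>A. A \<in> sets M \<Longrightarrow> emeasure N\<^sub>1 A = ennreal (\<rho> (A \<inter> S))"
    by (rule pos.finite_measure_of_nonneg) (use S in \<open>auto simp: positive_set_def\<close>)
  obtain N\<^sub>2 where N\<^sub>2: "finite_measure N\<^sub>2" "sets N\<^sub>2 = sets M"
    "\<And>A. A \<in> sets M \<Longrightarrow> emeasure N\<^sub>2 A = ennreal (- \<rho> (A - S))"
  proof (rule neg.finite_measure_of_nonneg)
    show "0 \<le> - \<rho> (A - S)" if "A \<in> sets M" for A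
      using neg[of "A - S"] that by auto
  qed blast
  have "\<rho> A = measure N\<^sub>1 A - measure N\<^sub>2 A" if A: "A \<in> sets M" for A
  proof -
    have "0 \<le> \<rho> (A \<inter> S)" "\<rho> (A - S) \<le> 0"
      using S A neg[of "A - S"] by (auto simp: positive_set_def)
    then have "measure N\<^sub>1 A = \<rho> (A \<inter> S)" "measure N\<^sub>2 A = - \<rho> (A - S)"
      using A by (simp_all add: measure_def N\<^sub>1 N\<^sub>2)
    moreover have "\<rho> ((A \<inter> S) \<union> (A - S)) = \<rho> (A \<inter> S) + \<rho> (A - S)"
      using A by (intro Un) auto
    moreover have "(A \<inter> S) \<union> (A - S) = A"
      by auto
    ultimately show ?thesis by simp
  qed
  moreover have "emeasure N\<^sub>1 (space M - S) = 0" "emeasure N\<^sub>2 S = 0"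
    using empty by (simp_all add: N\<^sub>1 N\<^sub>2 Diff_Int_distrib2)
  ultimately have "jordan_decomposition M \<rho> N\<^sub>1 N\<^sub>2"
    using N\<^sub>1 N\<^sub>2 \<open>S \<in> sets M\<close> unfolding jordan_decomposition_def by blast
  then show ?thesis by blast
qed

section \<open>The norm of a complex measure and integration against it\<close>

text \<open>The parts are a choice among Jordan decompositions, so their existence is what gives this choice
  any property at all.\<close>

lemma jordan_decomposition_jordan_parts:
  assumes "signed_measure M \<rho>"
  shows "jordan_decomposition M \<rho> (fst (jordan_parts M \<rho>)) (snd (jordan_parts M \<rho>))"
proof -
  have "\<exists>p. case p of (N\<^sub>1, N\<^sub>2) \<Rightarrow> jordan_decomposition M \<rho> N\<^sub>1 N\<^sub>2"
    using signed_measure.Jordan_decomposition[OF assms] by auto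
  then have "case jordan_parts M \<rho> of (N\<^sub>1, N\<^sub>2) \<Rightarrow> jordan_decomposition M \<rho> N\<^sub>1 N\<^sub>2"
    unfolding jordan_parts_def by (rule someI_ex)
  then show ?thesis
    by (simp add: case_prod_beta)
qed

lemma complex_measure_jordan_decompositions:
  assumes "complex_measure M \<nu>"
  shows "jordan_decomposition M (\<lambda>A. Re (\<nu> A)) (re_pos M \<nu>) (re_neg M \<nu>)"
    and "jordan_decomposition M (\<lambda>A. Im (\<nu> A)) (im_pos M \<nu>) (im_neg M \<nu>)"
proof -
  have "signed_measure M (\<lambda>A. Re (\<nu> A))" "signed_measure M (\<lambda>A. Im (\<nu> A))"
    using assms by (auto simp: signed_measure_def complex_measure_def intro: sums_Re sums_Im)
  then show "jordan_decomposition M (\<lambda>A. Re (\<nu> A)) (re_pos M \<nu>) (re_neg M \<nu>)"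
    and "jordan_decomposition M (\<lambda>A. Im (\<nu> A)) (im_pos M \<nu>) (im_neg M \<nu>)"
    unfolding re_pos_def re_neg_def im_pos_def im_neg_def
    by (auto dest: jordan_decomposition_jordan_parts)
qed

text \<open>The integral of a function that is not integrable is \<open>0\<close> by convention. So the bound covers
  functions that are bounded but not measurable, and can be applied to the inner integrals of an
  iterated integral whatever the dependence of these on the outer variable.\<close>

lemma norm_integral_le_measure:
  fixes f :: "'a \<Rightarrow> complex"
  assumes "finite_measure N" and "0 \<le> B" and B: "\<And>x. x \<in> space N \<Longrightarrow> cmod (f x) \<le> B"
  shows "cmod (integral\<^sup>L N f) \<le> B * measure N (space N)"
proof (cases "integrable N f")
  case True
  interpret finite_measure N by fact
  have "cmod (integral\<^sup>L N f) \<le> (\<integral>x. cmod (f x) \<partial>N)"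
    by (rule integral_norm_bound)
  also have "\<dots> \<le> (\<integral>x. B \<partial>N)"
    using True B by (intro integral_mono) auto
  finally show ?thesis by (simp add: mult.commute)
next
  case False
  then show ?thesis
    using \<open>0 \<le> B\<close> by (simp add: not_integrable_integral_eq)
qed

lemma norm_cm_integral_le:
  assumes \<nu>: "complex_measure M \<nu>" and "0 \<le> B" and B: "\<And>x. x \<in> space M \<Longrightarrow> cmod (f x) \<le> B"
  shows "cmod (cm_integral M \<nu> f) \<le> B * cm_norm M \<nu>"
proof -
  have part: "cmod (integral\<^sup>L N f) \<le> B * measure N (space M)"
    if "N \<in> {re_pos M \<nu>, re_neg M \<nu>, im_pos M \<nu>, im_neg M \<nu>}" for N
  proof -
    have N: "finite_measure N" "sets N = sets M"
      using that complex_measure_jordan_decompositions[OF \<nu>]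
      by (auto simp: jordan_decomposition_def)
    then show ?thesis
      using norm_integral_le_measure[of N B f] assms sets_eq_imp_space_eq[of N M] by simp
  qed
  let ?I = "\<lambda>N. integral\<^sup>L N f"
  have "cmod (cm_integral M \<nu> f) \<le> cmod (?I (re_pos M \<nu>) - ?I (re_neg M \<nu>)) +
      cmod (?I (im_pos M \<nu>) - ?I (im_neg M \<nu>))"
    unfolding cm_integral_def by (rule order_trans[OF norm_triangle_ineq]) (simp add: norm_mult)
  also have "\<dots> \<le> (cmod (?I (re_pos M \<nu>)) + cmod (?I (re_neg M \<nu>))) +
      (cmod (?I (im_pos M \<nu>)) + cmod (?I (im_neg M \<nu>)))"
    by (intro add_mono norm_triangle_ineq4)
  also have "\<dots> \<le> B * cm_norm M \<nu>"
    using part[of "re_pos M \<nu>"] part[of "re_neg M \<nu>"] part[of "im_pos M \<nu>"] part[of "im_neg M \<nu>"]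
    unfolding cm_norm_def by (simp add: distrib_left)
  finally show ?thesis .
qed

lemma Re_le_cm_norm:
  assumes "complex_measure M \<nu>"
  shows "Re (\<nu> (space M)) \<le> cm_norm M \<nu>"
proof -
  have "Re (\<nu> (space M)) = measure (re_pos M \<nu>) (space M) - measure (re_neg M \<nu>) (space M)"
    using complex_measure_jordan_decompositions(1)[OF assms] by (simp add: jordan_decomposition_def)
  then show ?thesis
    unfolding cm_norm_def by (smt (verit) measure_nonneg)
qed

section \<open>Bounds for iterated integrals along a path\<close>

text \<open>In the induction the last \<open>n\<close> integrals form a function of the first coordinate which is
  bounded by \<open>B\<close> times the last \<open>n\<close> factors; the outermost integral contributes \<open>c 0\<close>.\<close>

lemma (in transition_measure) norm_path_integral_le:
  assumes "distinct (t # us)" "set (t # us) \<subseteq> T" "x \<in> space (U t)"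
    and c: "\<And>k y. k < length us \<Longrightarrow> y \<in> space (U ((t # us) ! k)) \<Longrightarrow>
          cm_norm (U (us ! k)) (P ((t # us) ! k) y (us ! k)) \<le> c k"
    and c0: "\<And>k. k < length us \<Longrightarrow> 0 \<le> c k"
    and "0 \<le> B" "\<And>w. cmod (F w) \<le> B"
  shows "cmod (path_integral U P F t x us w) \<le> B * (\<Prod>k<length us. c k)"
  using assms(1-5)
proof (induction us arbitrary: t x w c)
  case Nil
  then show ?case using assms(7) by simp
next
  case (Cons u us)
  let ?p = "\<Prod>k<length us. c (Suc k)"
  have p: "0 \<le> B * ?p"
    using Cons.prems(5) \<open>0 \<le> B\<close> by (intro mult_nonneg_nonneg prod_nonneg) auto
  have IH: "cmod (path_integral U P F u y us (w(u := y))) \<le> B * ?p" if "y \<in> space (U u)" for y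
  proof (rule Cons.IH)
    fix k z assume "k < length us" "z \<in> space (U ((u # us) ! k))"
    then show "cm_norm (U (us ! k)) (P ((u # us) ! k) z (us ! k)) \<le> c (Suc k)"
      using Cons.prems(4)[of "Suc k" z] by simp
  qed (use Cons.prems that in auto)
  have "cmod (path_integral U P F t x (u # us) w) \<le> (B * ?p) * cm_norm (U u) (P t x u)"
    unfolding path_integral.simps
    by (rule norm_cm_integral_le[OF sigma_additive p IH]) (use Cons.prems in auto)
  also have "\<dots> \<le> (B * ?p) * c 0"
    using Cons.prems(3) Cons.prems(4)[of 0 x] p by (intro mult_left_mono) auto
  also have "\<dots> = B * (\<Prod>k<length (u # us). c k)"
    by (simp add: prod.lessThan_Suc_shift mult_ac del: prod.lessThan_Suc)
  finally show ?case .
qed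

lemma ereal_ln_ereal: "0 < x \<Longrightarrow> ereal_ln (ereal x) = ereal (ln x)"
  by (auto simp: ereal_ln_def)

text \<open>A transition out of an empty state space has supremum \<open>-\<infinity>\<close>, whence the hypothesis on \<open>x\<close>.\<close>

lemma (in normalized_transition_measure) one_le_transition_sup:
  assumes "s \<in> T" "t \<in> T" "s \<noteq> t" "x \<in> space (U s)"
  shows "1 \<le> transition_sup U P s t"
proof -
  have "1 \<le> cm_norm (U t) (P s x t)"
    using Re_le_cm_norm[OF sigma_additive[OF assms]] normalized[OF assms] by simp
  then show ?thesis
    unfolding transition_sup_def
    by (intro SUP_upper2[OF assms(4)]) simp
qed

text \<open>An infinite supremum at one step would make the sum of the logarithms infinite, against the
  bound \<open>K\<close>. Hence all suprema are real and at least \<open>1\<close>, and their product is the exponential of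
  that sum. The state spaces are nonempty so that there is a starting point to which
  normalization applies.\<close>

lemma (in normalized_transition_measure) norm_markov_measure_le:
  assumes q: "q \<in> time_tuples T t\<^sub>0" and x\<^sub>0: "x\<^sub>0 \<in> space (U t\<^sub>0)"
    and ne: "\<And>t. t \<in> T \<Longrightarrow> space (U t) \<noteq> {}"
    and K: "transition_bound T t\<^sub>0 U P \<le> ereal K"
  shows "cmod (markov_measure U P x\<^sub>0 q E) \<le> exp K"
proof -
  obtain us where us: "q = t\<^sub>0 # us" "distinct (t\<^sub>0 # us)" "set (t\<^sub>0 # us) \<subseteq> T"
    using q unfolding time_tuples_def by (cases q) auto
  define g where "g k = transition_sup U P ((t\<^sub>0 # us) ! k) (us ! k)" for k
  define c where "c k = real_of_ereal (g k)" for k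
  have "(\<Sum>k<length us. ereal_ln (g k)) =
      (\<Sum>k=1..<length q. ereal_ln (transition_sup U P (q ! (k - 1)) (q ! k)))"
    using us(1) sum.shift_bounds_Suc_ivl
      [of "\<lambda>k. ereal_ln (transition_sup U P (q ! (k - 1)) (q ! k))" 0 "length us"]
    by (simp add: g_def atLeast0LessThan)
  also have "\<dots> \<le> transition_bound T t\<^sub>0 U P"
    unfolding transition_bound_def using q by (rule SUP_upper)
  finally have le: "(\<Sum>k<length us. ereal_ln (g k)) \<le> ereal K"
    using K by (rule order_trans)
  have step: "(t\<^sub>0 # us) ! k \<in> T" "us ! k \<in> T" "(t\<^sub>0 # us) ! k \<noteq> us ! k" if "k < length us" for k
  proof -
    have "(t\<^sub>0 # us) ! k \<in> set (t\<^sub>0 # us)" "us ! k \<in> set us"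
      using that by (auto intro!: nth_mem simp del: set_simps)
    then show "(t\<^sub>0 # us) ! k \<in> T" "us ! k \<in> T"
      using us(3) by auto
    have "(t\<^sub>0 # us) ! k \<noteq> (t\<^sub>0 # us) ! Suc k"
      using that us(2) by (subst nth_eq_iff_index_eq) auto
    then show "(t\<^sub>0 # us) ! k \<noteq> us ! k" by simp
  qed
  have g1: "1 \<le> g k" if "k < length us" for k
    using one_le_transition_sup[OF step[OF that]] ne[OF step(1)[OF that]]
    unfolding g_def by blast
  have fin: "g k \<noteq> \<infinity>" if k: "k < length us" for k
  proof
    assume "g k = \<infinity>"
    then have "ereal_ln (g k) = \<infinity>"
      by (simp add: ereal_ln_def)
    then have "(\<Sum>k<length us. ereal_ln (g k)) = \<infinity>"
      using k unfolding sum_Pinfty by auto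
    with le show False by simp
  qed
  have gc: "g k = ereal (c k)" "1 \<le> c k" if "k < length us" for k
    using g1[OF that] fin[OF that] unfolding c_def by (cases "g k"; simp)+
  have "(\<Sum>k<length us. ereal_ln (g k)) = (\<Sum>k<length us. ereal (ln (c k)))"
    using gc by (intro sum.cong refl) (force simp: ereal_ln_ereal)
  with le have ln_le: "(\<Sum>k<length us. ln (c k)) \<le> K"
    by simp
  have "cmod (path_integral U P (indicator E) t\<^sub>0 x\<^sub>0 us (\<lambda>_. undefined)) \<le> 1 * (\<Prod>k<length us. c k)"
  proof (rule norm_path_integral_le[OF us(2,3) x\<^sub>0])
    fix k y assume k: "k < length us" and y: "y \<in> space (U ((t\<^sub>0 # us) ! k))"
    have "ereal (cm_norm (U (us ! k)) (P ((t\<^sub>0 # us) ! k) y (us ! k))) \<le> g k"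
      unfolding g_def transition_sup_def using y by (rule SUP_upper)
    then show "cm_norm (U (us ! k)) (P ((t\<^sub>0 # us) ! k) y (us ! k)) \<le> c k"
      using gc[OF k] by simp
  qed (use gc in \<open>force simp: indicator_def\<close>)+
  also have "\<dots> = exp (\<Sum>k<length us. ln (c k))"
    using gc(2) by (force simp: exp_sum intro!: prod.cong)
  also have "\<dots> \<le> exp K"
    using ln_le by simp
  finally show ?thesis
    by (simp add: markov_measure_def us(1))
qed

section \<open>Boundedness of the Markov quasimeasure\<close>

theorem proposition3p3p1:
  fixes av :: "'k::field \<Rightarrow> real"
    and smul :: "'k \<Rightarrow> 'x::topological_ab_group_add \<Rightarrow> 'x"
    and t\<^sub>0 :: 'k and r :: real and T :: "'k set"
    and U :: "'k \<Rightarrow> 'x measure"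
    and P :: "'k \<Rightarrow> 'x \<Rightarrow> 'k \<Rightarrow> 'x set \<Rightarrow> complex"
    and x\<^sub>0 :: 'x
  assumes "local_field av"
    and "locally_convex_space av smul"
    and "r > 0"
    and "T = Metric_space.mcball UNIV (av_dist av) t\<^sub>0 r"
    and "\<And>t. t \<in> T \<Longrightarrow> space (U t) = UNIV"
    and "normalized_transition_measure T U P"
    and "transition_bound T t\<^sub>0 U P < \<infinity>"
  shows "bounded_quasimeasure (markov_quasimeasure T t\<^sub>0 U P x\<^sub>0)"
proof -
  interpret normalized_transition_measure T U P by fact
  obtain K where K: "transition_bound T t\<^sub>0 U P \<le> ereal K"
    using assms(7) by (cases "transition_bound T t\<^sub>0 U P") auto
  have "cmod (markov_measure U P x\<^sub>0 q E) \<le> exp K" if q: "q \<in> time_tuples T t\<^sub>0" for q E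
  proof (rule norm_markov_measure_le[OF q _ _ K])
    have "t\<^sub>0 \<in> T"
      using q unfolding time_tuples_def by (cases q) auto
    then show "x\<^sub>0 \<in> space (U t\<^sub>0)"
      using assms(5) by simp
  qed (use assms(5) in simp)
  then have "(SUP (A, c)\<in>markov_quasimeasure T t\<^sub>0 U P x\<^sub>0. ereal (cmod c)) \<le> ereal (exp K)"
    by (intro SUP_least) (auto simp: markov_quasimeasure_def)
  also have "\<dots> < \<infinity>" by simp
  finally show ?thesis
    unfolding bounded_quasimeasure_def .
qed

end
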